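(* Let $M\subset E^{n}$ be a strong $r$-helix submanifold of dimension $n-k$ with space of helix directions $H(M)\subset E^{n}$. Let $\alpha : I\subset\mathbb{R}\to M$ be a unit speed curve on $M$ with normal curvature function $k_T=0$, let $V_2$ be the unit principal normal of $\alpha$ in $E^n$, and let $T_j$ be the tangent component of a direction $d_j\in H(M)$. If $\langle V_2,T_j\rangle$ is a constant function along $\alpha$, then $\alpha$ is a slant helix in $E^{n}$.
   Context: $E^{n}=\mathbb{R}^{n}$ is Euclidean $n$-space with its standard inner product; manifolds, curves and fields are $C^\infty$. $\overline{D}$ is the standard covariant derivative (Riemannian connection) on $E^{n}$ and $D$ is the induced Riemannian connection on $M$. The second fundamental tensor $V$ of $M$ is defined by the Gauss equation $\overline{D}_XY=D_XY+V(X,Y)$ for $X,Y$ tangent to $M$, where $D_XY$ is the tangential and $V(X,Y)$ the normal component. For a unit speed curve $\alpha$ in $M$ with unit tangent $T=\alpha'$, the normal curvature is $k_T=\|V(T,T)\|$. Helix directions: let $M\subset \mathbb{R}^{n}$ be a submanifold. A unit vector $d\in\mathbb{R}^{n}$ is a helix direction of $M$ if the angle between $d$ and the tangent space $T_pM$ is constant (independent of $p\in M$). $H(M)$ denotes the set of helix directions of $M$; when it is regarded as a linear space, it consists of all scalar multiples of helix directions, and a "direction $d\in H(M)$" means a unit vector in it. $M$ is a strong $r$-helix submanifold if $H(M)$ is a linear subspace of $\mathbb{R}^{n}$ of dimension greater than or equal to $r$. Components of a direction: for a direction $d_j\in H(M)$, one decomposes $d_j=\cos(\theta_j)\,\xi_j+\sin(\theta_j)\,T_j$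 along $M$, with $\theta_j$ constant, $\xi_j$ a unit normal vector field of $M$ and $T_j$ a unit tangent vector field of $M$; $\xi_j$ and $T_j$ are called the normal and tangent components of $d_j$. Principal normal: $V_2$ is the second Frenet vector of the unit speed curve $\alpha$ in $E^n$, so that $\overline{D}_TT=\alpha''=k_1V_2$ with $k_1=\|\alpha''\|$; it is presupposed to be defined, i.e. $k_1>0$. Slant helix: a unit speed curve $\alpha: I\to E^{n}$ is a slant helix if its unit principal normal $V_2$ makes a constant angle with some fixed direction $U$ (a constant unit vector of $E^n$). *)

theory Defs
  imports "HOL-Analysis.Analysis"
begin

section \<open>Smooth maps\<close>

text \<open>Intended for open \<open>U\<close>: \<open>f\<close> is \<open>k\<close> times continuously differentiable on \<open>U\<close>,
  in terms of iterated directional derivatives.\<close>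

primrec Ck_on :: "nat \<Rightarrow> 'a::euclidean_space set \<Rightarrow> ('a \<Rightarrow> 'b::euclidean_space) \<Rightarrow> bool" where
  "Ck_on 0 U f \<longleftrightarrow> continuous_on U f"
| "Ck_on (Suc k) U f \<longleftrightarrow>
     f differentiable_on U \<and> (\<forall>v. Ck_on k U (\<lambda>x. frechet_derivative f (at x) v))"

text \<open>Smoothness on an arbitrary set (a submanifold, an interval with endpoints, an open set) is
  local extendability to a smooth map on an open set; for open \<open>S\<close> this is smoothness as usual.\<close>

definition smooth_on :: "'a::euclidean_space set \<Rightarrow> ('a \<Rightarrow> 'b::euclidean_space) \<Rightarrow> bool" where
  "smooth_on S f \<longleftrightarrow>
     (\<forall>p\<in>S. \<exists>U g. open U \<and> p \<in> U \<and> (\<forall>k. Ck_on k U g) \<and> (\<forall>q\<in>S \<inter> U. f q = g q))"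

section \<open>Submanifolds of Euclidean space\<close>

text \<open>Slice charts: near each of its points, \<open>M\<close> is straightened to an \<open>m\<close>-dimensional linear
  subspace by a diffeomorphism between open subsets of the ambient space.\<close>

definition submanifold :: "nat \<Rightarrow> 'a::euclidean_space set \<Rightarrow> bool" where
  "submanifold m M \<longleftrightarrow>
     (\<forall>p\<in>M. \<exists>U W \<phi> \<psi> S. open U \<and> p \<in> U \<and> open W \<and>
        homeomorphism U W \<phi> \<psi> \<and> smooth_on U \<phi> \<and> smooth_on W (\<psi> :: 'a \<Rightarrow> 'a) \<and>
        subspace S \<and> dim S = m \<and> \<phi> ` (M \<inter> U) = S \<inter> W)"

definition tangent_space :: "'a::euclidean_space set \<Rightarrow> 'a \<Rightarrow> 'a set" where
  "tangent_space M p =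
     {v. \<exists>\<epsilon>>0. \<exists>\<gamma>::real \<Rightarrow> 'a. smooth_on {-\<epsilon><..<\<epsilon>} \<gamma> \<and> \<gamma> ` {-\<epsilon><..<\<epsilon>} \<subseteq> M \<and>
        \<gamma> 0 = p \<and> (\<gamma> has_vector_derivative v) (at 0)}"

abbreviation normal_space :: "'a::euclidean_space set \<Rightarrow> 'a \<Rightarrow> 'a set" where
  "normal_space M p \<equiv> (tangent_space M p)\<^sup>\<bottom>"

text \<open>\<open>V(v,w)\<close> at \<open>p\<close>, for tangent vectors \<open>v\<close> and \<open>w\<close> at \<open>p\<close>, by the Gauss equation: extend \<open>w\<close> to a
  smooth map \<open>Y\<close> near \<open>p\<close> in the ambient space that is tangent to \<open>M\<close> along \<open>M\<close>, and decompose the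
  Euclidean derivative of \<open>Y\<close> in direction \<open>v\<close> into its tangential part \<open>a\<close> (the induced
  connection) and its normal part \<open>u\<close>. The value \<open>u\<close> does not depend on the choice of \<open>Y\<close>.\<close>

definition second_fundamental_form ::
    "'a::euclidean_space set \<Rightarrow> 'a \<Rightarrow> 'a \<Rightarrow> 'a \<Rightarrow> 'a" where
  "second_fundamental_form M p v w =
     (THE u. \<exists>U Y a. open U \<and> p \<in> U \<and> smooth_on U Y \<and>
        (\<forall>q\<in>M \<inter> U. Y q \<in> tangent_space M q) \<and> Y p = w \<and>
        a \<in> tangent_space M p \<and> u \<in> normal_space M p \<and>
        frechet_derivative Y (at p) v = a + u)"

section \<open>Helix directions\<close>

definition vec_angle :: "'a::real_inner \<Rightarrow> 'a \<Rightarrow> real" where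
  "vec_angle u v = arccos (u \<bullet> v / (norm u * norm v))"

text \<open>Angle in \<open>[0, \<pi>/2]\<close> between a nonzero vector and a linear subspace. The closest point
  of the subspace is the orthogonal projection; if it is \<open>0\<close>, the angle is \<open>\<pi>/2\<close>.\<close>

definition subspace_angle :: "'a::euclidean_space \<Rightarrow> 'a set \<Rightarrow> real" where
  "subspace_angle d S = arccos (norm (closest_point S d) / norm d)"

definition helix_direction :: "'a::euclidean_space set \<Rightarrow> 'a \<Rightarrow> bool" where
  "helix_direction M d \<longleftrightarrow>
     norm d = 1 \<and> (\<lambda>p. subspace_angle d (tangent_space M p)) constant_on M"

definition helix_space :: "'a::euclidean_space set \<Rightarrow> 'a set" where
  "helix_space M = {c *\<^sub>R d | c d. helix_direction M d}"

definition strong_helix :: "nat \<Rightarrow> 'a::euclidean_space set \<Rightarrow> bool" where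
  "strong_helix r M \<longleftrightarrow> subspace (helix_space M) \<and> r \<le> dim (helix_space M)"

text \<open>\<open>T\<close> is the tangent component of \<open>d\<close> in a decomposition with constant angle \<open>\<theta>\<close>, along \<open>M\<close>.
  When \<open>sin \<theta> = 0\<close> the field \<open>T\<close> is not determined by \<open>d\<close>, hence a predicate.\<close>

definition tangent_component :: "'a::euclidean_space set \<Rightarrow> 'a \<Rightarrow> ('a \<Rightarrow> 'a) \<Rightarrow> bool" where
  "tangent_component M d T \<longleftrightarrow>
     (\<exists>\<theta>::real. \<exists>\<xi>. smooth_on M \<xi> \<and> smooth_on M T \<and>
        (\<forall>p\<in>M. \<xi> p \<in> normal_space M p \<and> norm (\<xi> p) = 1 \<and>
               T p \<in> tangent_space M p \<and> norm (T p) = 1 \<and>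
               d = cos \<theta> *\<^sub>R \<xi> p + sin \<theta> *\<^sub>R T p))"

section \<open>Curves\<close>

text \<open>The interval \<open>I\<close> may contain endpoints, where derivatives are one-sided.\<close>

definition curve_deriv :: "real set \<Rightarrow> (real \<Rightarrow> 'a::euclidean_space) \<Rightarrow> real \<Rightarrow> 'a" where
  "curve_deriv I \<alpha> t = vector_derivative \<alpha> (at t within I)"

definition unit_speed_curve :: "real set \<Rightarrow> (real \<Rightarrow> 'a::euclidean_space) \<Rightarrow> bool" where
  "unit_speed_curve I \<alpha> \<longleftrightarrow>
     is_interval I \<and> interior I \<noteq> {} \<and> smooth_on I \<alpha> \<and> (\<forall>t\<in>I. norm (curve_deriv I \<alpha> t) = 1)"

definition normal_curvature ::
    "'a::euclidean_space set \<Rightarrow> real set \<Rightarrow> (real \<Rightarrow> 'a) \<Rightarrow> real \<Rightarrow> real" where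
  "normal_curvature M I \<alpha> t =
     norm (second_fundamental_form M (\<alpha> t) (curve_deriv I \<alpha> t) (curve_deriv I \<alpha> t))"

definition curvature :: "real set \<Rightarrow> (real \<Rightarrow> 'a::euclidean_space) \<Rightarrow> real \<Rightarrow> real" where
  "curvature I \<alpha> t = norm (curve_deriv I (curve_deriv I \<alpha>) t)"

definition principal_normal :: "real set \<Rightarrow> (real \<Rightarrow> 'a::euclidean_space) \<Rightarrow> real \<Rightarrow> 'a" where
  "principal_normal I \<alpha> t = curve_deriv I (curve_deriv I \<alpha>) t /\<^sub>R curvature I \<alpha> t"

definition slant_helix :: "real set \<Rightarrow> (real \<Rightarrow> 'a::euclidean_space) \<Rightarrow> bool" where
  "slant_helix I \<alpha> \<longleftrightarrow>
     unit_speed_curve I \<alpha> \<and> (\<forall>t\<in>I. curvature I \<alpha> t > 0) \<and>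
     (\<exists>u. norm u = 1 \<and> (\<lambda>t. vec_angle (principal_normal I \<alpha> t) u) constant_on I)"

end

theory Submission
  imports Defs
begin

text \<open>The slant axis is \<open>d\<close> itself. Along the curve
  \<open>\<langle>V\<^sub>2, d\<rangle> = cos \<theta> \<langle>V\<^sub>2, \<xi>\<rangle> + sin \<theta> \<langle>V\<^sub>2, T\<rangle>\<close>, and the last term is constant by assumption, so it
  suffices that the acceleration \<open>\<alpha>''\<close> is tangent to \<open>M\<close>: the normal component of \<open>\<alpha>''\<close> is
  \<open>V(\<alpha>', \<alpha>')\<close>, which vanishes.

  This Gauss formula for a curve, and the independence of \<open>V\<close> from the extension \<open>Y\<close> of the second
  argument, both rest on one fact (\<open>tangent_field_derivative_at_zero\<close>): if a vector field along a
  curve in \<open>M\<close> is tangent to \<open>M\<close> and vanishes at a time \<open>t\<close>, then its derivative at \<open>t\<close> is tangent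
  to \<open>M\<close>. Two extensions of \<open>\<alpha>'(t)\<close>, or one extension and the velocity \<open>\<alpha>'\<close> itself, differ along
  \<open>\<alpha>\<close> by such a field, hence their derivatives have the same normal part.
  The fact is proved by pushing the field forward by a slice chart, where tangency means membership in
  a fixed linear subspace, so that only the continuity of the derivative of the chart is needed and
  no symmetry of second derivatives.

  The value \<open>V(v, w)\<close> is meaningful only if some smooth tangent extension of \<open>w\<close> exists. It is
  obtained by pulling back a constant field through a slice chart (\<open>tangent_extension\<close>), whose
  smoothness requires the closure of the \<open>C\<^sup>k\<close> maps under products and compositions.\<close>

section \<open>Calculus of \<open>C\<^sup>k\<close> maps on open sets\<close>

lemma Ck_on_Suc_has_derivative:
  assumes "Ck_on (Suc k) U f" "open U" "x \<in> U"
  shows "(f has_derivative frechet_derivative f (at x)) (at x)"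
  using assms by (simp add: differentiable_on_eq_differentiable_at frechet_derivative_works)

lemma Ck_on_cong:
  assumes "open U" "Ck_on k U f" "\<And>x. x \<in> U \<Longrightarrow> f x = g x"
  shows "Ck_on k U g"
  using assms(2,3)
proof (induction k arbitrary: f g)
  case 0
  then show ?case by (simp cong: continuous_on_cong)
next
  case (Suc k)
  have D: "(g has_derivative frechet_derivative f (at x)) (at x)" if "x \<in> U" for x
    using has_derivative_transform_within_open[OF Ck_on_Suc_has_derivative[OF Suc.prems(1) assms(1) that]
        assms(1) that] Suc.prems(2) by blast
  then have "g differentiable_on U"
    unfolding differentiable_on_eq_differentiable_at[OF assms(1)] by (meson differentiableI)
  moreover have "Ck_on k U (\<lambda>x. frechet_derivative g (at x) v)" for v
    by (rule Suc.IH[of "\<lambda>x. frechet_derivative f (at x) v"])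
      (use Suc.prems(1) in \<open>auto simp: frechet_derivative_at[OF D]\<close>)
  ultimately show ?case by simp
qed

lemma Ck_on_SucI:
  assumes "open U" "\<And>x. x \<in> U \<Longrightarrow> (f has_derivative f' x) (at x)" "\<And>v. Ck_on k U (\<lambda>x. f' x v)"
  shows "Ck_on (Suc k) U f"
proof -
  have "f differentiable_on U"
    unfolding differentiable_on_eq_differentiable_at[OF assms(1)] using assms(2) by (meson differentiableI)
  moreover have "Ck_on k U (\<lambda>x. frechet_derivative f (at x) v)" for v
    by (rule Ck_on_cong[OF assms(1) assms(3)[of v]]) (simp add: frechet_derivative_at[OF assms(2), symmetric])
  ultimately show ?thesis by simp
qed

lemma Ck_on_SucD: "Ck_on (Suc k) U f \<Longrightarrow> Ck_on k U f"
proof (induction k arbitrary: f)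
  case 0
  then show ?case by (simp add: differentiable_imp_continuous_on)
next
  case (Suc k)
  then show ?case unfolding Ck_on.simps(2)[of "Suc k"] Ck_on.simps(2)[of k U f] by blast
qed

lemma Ck_on_subset: "Ck_on k U f \<Longrightarrow> V \<subseteq> U \<Longrightarrow> Ck_on k V f"
  by (induction k arbitrary: f) (auto intro: continuous_on_subset differentiable_on_subset)

lemma Ck_on_const: "Ck_on k U (\<lambda>x. c)"
  by (induction k arbitrary: c) auto

lemma Ck_on_linear_image:
  assumes "open U" "bounded_linear L" "Ck_on k U f"
  shows "Ck_on k U (\<lambda>x. L (f x))"
  using assms(3)
proof (induction k arbitrary: f)
  case 0
  then show ?case using assms(2) by (auto intro: bounded_linear.continuous_on)
next
  case (Suc k)
  show ?case
  proof (rule Ck_on_SucI[OF assms(1)])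
    show "((\<lambda>x. L (f x)) has_derivative (\<lambda>v. L (frechet_derivative f (at x) v))) (at x)" if "x \<in> U" for x
      by (rule bounded_linear.has_derivative[OF assms(2) Ck_on_Suc_has_derivative[OF Suc.prems assms(1) that]])
  qed (use Suc in auto)
qed

lemma Ck_on_add:
  assumes "open U" "Ck_on k U f" "Ck_on k U g"
  shows "Ck_on k U (\<lambda>x. f x + g x)"
  using assms(2,3)
proof (induction k arbitrary: f g)
  case 0
  then show ?case by (auto intro: continuous_intros)
next
  case (Suc k)
  show ?case
  proof (rule Ck_on_SucI[OF assms(1)])
    show "((\<lambda>x. f x + g x) has_derivative
        (\<lambda>v. frechet_derivative f (at x) v + frechet_derivative g (at x) v)) (at x)" if "x \<in> U" for x
      using Ck_on_Suc_has_derivative[OF Suc.prems(1) assms(1) that]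
        Ck_on_Suc_has_derivative[OF Suc.prems(2) assms(1) that] by (rule has_derivative_add)
  qed (use Suc in auto)
qed

lemma Ck_on_sum:
  assumes "open U" "finite B" "\<And>b. b \<in> B \<Longrightarrow> Ck_on k U (f b)"
  shows "Ck_on k U (\<lambda>x. \<Sum>b\<in>B. f b x)"
  using assms(2,3)
  by (induction B) (simp_all add: Ck_on_const Ck_on_add assms(1))

lemma Ck_on_scaleR:
  fixes c :: "'a::euclidean_space \<Rightarrow> real"
  assumes "open U" "Ck_on k U c" "Ck_on k U f"
  shows "Ck_on k U (\<lambda>x. c x *\<^sub>R f x)"
  using assms(2,3)
proof (induction k arbitrary: c f)
  case 0
  then show ?case by (auto intro: continuous_intros)
next
  case (Suc k)
  show ?case
  proof (rule Ck_on_SucI[OF assms(1)])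
    show "((\<lambda>x. c x *\<^sub>R f x) has_derivative
        (\<lambda>v. c x *\<^sub>R frechet_derivative f (at x) v + frechet_derivative c (at x) v *\<^sub>R f x)) (at x)"
      if "x \<in> U" for x
      using Ck_on_Suc_has_derivative[OF Suc.prems(1) assms(1) that]
        Ck_on_Suc_has_derivative[OF Suc.prems(2) assms(1) that] by (rule has_derivative_scaleR)
    show "Ck_on k U (\<lambda>x. c x *\<^sub>R frechet_derivative f (at x) v + frechet_derivative c (at x) v *\<^sub>R f x)" for v
      using Suc.prems Ck_on_SucD[OF Suc.prems(1)] Ck_on_SucD[OF Suc.prems(2)]
      by (intro Ck_on_add[OF assms(1)] Suc.IH) auto
  qed
qed

lemma linear_eq_sum_Basis:
  assumes "linear L"
  shows "L v = (\<Sum>b\<in>Basis. (v \<bullet> b) *\<^sub>R L b)"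
proof -
  have "L v = L (\<Sum>b\<in>Basis. (v \<bullet> b) *\<^sub>R b)" by (simp add: euclidean_representation)
  also have "\<dots> = (\<Sum>b\<in>Basis. (v \<bullet> b) *\<^sub>R L b)"
    by (simp add: linear_sum[OF assms] linear_scale[OF assms])
  finally show ?thesis .
qed

text \<open>Only the partial derivatives of \<open>g\<close> in fixed directions are known to be \<open>C\<^sup>k\<close>, so the direction
  \<open>f'(x) v\<close> in the chain rule, which varies with \<open>x\<close>, is expanded in the standard basis.\<close>

lemma Ck_on_compose:
  assumes "open U" "open V" "Ck_on k U f" "Ck_on k V g" "f ` U \<subseteq> V"
  shows "Ck_on k U (\<lambda>x. g (f x))"
  using assms(3,4)
proof (induction k arbitrary: g)
  case 0
  then show ?case using assms(5) by (auto intro: continuous_on_compose2)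
next
  case (Suc k)
  show ?case
  proof (rule Ck_on_SucI[OF assms(1)])
    fix x assume x: "x \<in> U"
    have g: "(g has_derivative frechet_derivative g (at (f x))) (at (f x))"
      using Ck_on_Suc_has_derivative[OF Suc.prems(2) assms(2)] assms(5) x by blast
    have "((\<lambda>x. g (f x)) has_derivative
        (\<lambda>v. frechet_derivative g (at (f x)) (frechet_derivative f (at x) v))) (at x)"
      using diff_chain_at[OF Ck_on_Suc_has_derivative[OF Suc.prems(1) assms(1) x] g] by (simp add: o_def)
    then show "((\<lambda>x. g (f x)) has_derivative (\<lambda>v. \<Sum>b\<in>Basis. (frechet_derivative f (at x) v \<bullet> b) *\<^sub>R
        frechet_derivative g (at (f x)) b)) (at x)"
      by (simp only: linear_eq_sum_Basis[OF has_derivative_linear[OF g], symmetric])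
  next
    fix v
    show "Ck_on k U (\<lambda>x. \<Sum>b\<in>Basis. (frechet_derivative f (at x) v \<bullet> b) *\<^sub>R
        frechet_derivative g (at (f x)) b)"
    proof (intro Ck_on_sum Ck_on_scaleR assms(1) finite_Basis)
      show "Ck_on k U (\<lambda>x. frechet_derivative f (at x) v \<bullet> b)" for b
        using Suc.prems(1)
        by (intro Ck_on_linear_image[OF assms(1) bounded_linear_inner_left]) simp
      show "Ck_on k U (\<lambda>x. frechet_derivative g (at (f x)) b)" for b
        using Suc.prems Ck_on_SucD by (intro Suc.IH[of "\<lambda>y. frechet_derivative g (at y) b"]) auto
    qed
  qed
qed

lemma Ck_on_local:
  assumes "\<And>p. p \<in> S \<Longrightarrow> \<exists>U. open U \<and> p \<in> U \<and> Ck_on k U f"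
  shows "Ck_on k S f"
  using assms
proof (induction k arbitrary: f)
  case 0
  then show ?case
    by (metis Ck_on.simps(1) continuous_at_imp_continuous_on continuous_on_eq_continuous_at)
next
  case (Suc k)
  have "f differentiable at p" if "p \<in> S" for p
    using Suc.prems[OF that] by (metis Ck_on.simps(2) differentiable_on_eq_differentiable_at)
  then have "f differentiable_on S"
    by (simp add: differentiable_at_imp_differentiable_on)
  moreover have "Ck_on k S (\<lambda>x. frechet_derivative f (at x) v)" for v
    using Suc.prems by (intro Suc.IH) (metis Ck_on.simps(2))
  ultimately show ?case by simp
qed

lemma smooth_on_open_iff:
  assumes "open S"
  shows "smooth_on S f \<longleftrightarrow> (\<forall>k. Ck_on k S f)"
proof
  assume f: "smooth_on S f"
  show "\<forall>k. Ck_on k S f"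
  proof (intro allI Ck_on_local)
    fix k p assume "p \<in> S"
    then obtain U g where U: "open U" "p \<in> U" "\<And>k. Ck_on k U g" "\<And>q. q \<in> S \<inter> U \<Longrightarrow> f q = g q"
      using f unfolding smooth_on_def by meson
    have "Ck_on k (S \<inter> U) f"
      by (rule Ck_on_cong[OF _ Ck_on_subset[OF U(3)]]) (use assms U in auto)
    then show "\<exists>U. open U \<and> p \<in> U \<and> Ck_on k U f"
      using U \<open>p \<in> S\<close> assms by blast
  qed
next
  assume "\<forall>k. Ck_on k S f"
  then show "smooth_on S f" using assms unfolding smooth_on_def by blast
qed

lemma smooth_on_compose:
  assumes "open U" "open V" "smooth_on U f" "smooth_on V g" "f ` U \<subseteq> V"
  shows "smooth_on U (\<lambda>x. g (f x))"
  using assms(3,4) unfolding smooth_on_open_iff[OF assms(1)] smooth_on_open_iff[OF assms(2)]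
  by (intro allI Ck_on_compose[where g = g, OF assms(1,2) _ _ assms(5)]) auto

lemma smooth_on_directional_derivative:
  assumes "open U" "smooth_on U f"
  shows "smooth_on U (\<lambda>x. frechet_derivative f (at x) v)"
  using assms by (simp add: smooth_on_open_iff) (metis Ck_on.simps(2))

lemma smooth_on_has_derivative:
  assumes "open U" "smooth_on U f" "x \<in> U"
  shows "(f has_derivative frechet_derivative f (at x)) (at x)"
  using assms Ck_on_Suc_has_derivative smooth_on_open_iff by blast

lemma smooth_on_imp_continuous_on:
  assumes "open U" "smooth_on U f"
  shows "continuous_on U f"
  using assms smooth_on_open_iff Ck_on.simps(1) by blast

section \<open>Curves and linear subspaces\<close>

lemma has_vector_derivative_quotient_tendsto:
  fixes f :: "real \<Rightarrow> 'a::euclidean_space"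
  assumes "(f has_vector_derivative v) (at t within X)"
  shows "((\<lambda>s. (f s - f t) /\<^sub>R (s - t)) \<longlongrightarrow> v) (at t within X)"
proof (subst tendsto_componentwise_iff, intro ballI)
  fix b :: 'a
  have "((\<lambda>s. f s \<bullet> b) has_vector_derivative v \<bullet> b) (at t within X)"
    using bounded_linear.has_vector_derivative[OF bounded_linear_inner_left assms] .
  then have "((\<lambda>s. (f s \<bullet> b - f t \<bullet> b) / (s - t)) \<longlongrightarrow> v \<bullet> b) (at t within X)"
    by (simp add: has_real_derivative_iff_has_vector_derivative[symmetric] has_field_derivative_iff)
  then show "((\<lambda>s. ((f s - f t) /\<^sub>R (s - t)) \<bullet> b) \<longlongrightarrow> v \<bullet> b) (at t within X)"
    by (simp add: inner_diff_left divide_inverse_commute)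
qed

text \<open>The one-sided formulation covers the endpoints of an interval.\<close>

lemma vector_derivative_in_subspace:
  fixes f :: "real \<Rightarrow> 'a::euclidean_space"
  assumes "subspace S" "(f has_vector_derivative v) (at t within X)" "at t within X \<noteq> bot"
    and "f t \<in> S" "\<forall>\<^sub>F s in at t within X. f s \<in> S"
  shows "v \<in> S"
proof (rule Lim_in_closed_set[OF closed_subspace[OF assms(1)] _ assms(3)
      has_vector_derivative_quotient_tendsto[OF assms(2)]])
  show "\<forall>\<^sub>F s in at t within X. (f s - f t) /\<^sub>R (s - t) \<in> S"
    using assms(5) by eventually_elim (use assms(1,4) in \<open>auto intro: subspace_scale subspace_diff\<close>)
qed

section \<open>Slice charts and tangent spaces\<close>

locale slice_chart =
  fixes M :: "'a::euclidean_space set" and U W :: "'a set" and \<phi> \<psi> :: "'a \<Rightarrow> 'a" and S :: "'a set"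
  assumes open_U: "open U" and open_W: "open W" and homeo: "homeomorphism U W \<phi> \<psi>"
    and smooth_\<phi>: "smooth_on U \<phi>" and smooth_\<psi>: "smooth_on W \<psi>"
    and subspace_S: "subspace S" and slice: "\<phi> ` (M \<inter> U) = S \<inter> W"
begin

abbreviation "d\<phi> q \<equiv> frechet_derivative \<phi> (at q)"
abbreviation "d\<psi> y \<equiv> frechet_derivative \<psi> (at y)"

lemma d\<phi>: "q \<in> U \<Longrightarrow> (\<phi> has_derivative d\<phi> q) (at q)"
  by (rule smooth_on_has_derivative[OF open_U smooth_\<phi>])

lemma d\<psi>: "y \<in> W \<Longrightarrow> (\<psi> has_derivative d\<psi> y) (at y)"
  by (rule smooth_on_has_derivative[OF open_W smooth_\<psi>])

lemma \<phi>_in: "q \<in> U \<Longrightarrow> \<phi> q \<in> W" and \<psi>_in: "y \<in> W \<Longrightarrow> \<psi> y \<in> U"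
  and \<psi>_\<phi>: "q \<in> U \<Longrightarrow> \<psi> (\<phi> q) = q" and \<phi>_\<psi>: "y \<in> W \<Longrightarrow> \<phi> (\<psi> y) = y"
  using homeo unfolding homeomorphism_def by auto

lemma \<psi>_slice: "y \<in> S \<inter> W \<Longrightarrow> \<psi> y \<in> M \<inter> U"
  using slice \<psi>_\<phi> by (metis IntD2 imageE)

lemma d\<psi>_d\<phi>:
  assumes "q \<in> U"
  shows "d\<psi> (\<phi> q) (d\<phi> q v) = v"
proof -
  have "((\<psi> \<circ> \<phi>) has_derivative (d\<psi> (\<phi> q) \<circ> d\<phi> q)) (at q)"
    by (rule diff_chain_at[OF d\<phi>[OF assms] d\<psi>[OF \<phi>_in[OF assms]]])
  moreover have "((\<psi> \<circ> \<phi>) has_derivative id) (at q)"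
    by (rule has_derivative_transform_within_open[OF has_derivative_id open_U assms]) (simp add: \<psi>_\<phi>)
  ultimately show ?thesis by (metis has_derivative_unique o_apply id_apply)
qed

lemma d\<phi>_d\<psi>:
  assumes "q \<in> U"
  shows "d\<phi> q (d\<psi> (\<phi> q) w) = w"
proof -
  have "((\<phi> \<circ> \<psi>) has_derivative (d\<phi> q \<circ> d\<psi> (\<phi> q))) (at (\<phi> q))"
    by (rule diff_chain_at[OF d\<psi>[OF \<phi>_in[OF assms]]]) (simp add: \<psi>_\<phi> assms d\<phi>)
  moreover have "((\<phi> \<circ> \<psi>) has_derivative id) (at (\<phi> q))"
    by (rule has_derivative_transform_within_open[OF has_derivative_id open_W \<phi>_in[OF assms]]) (simp add: \<phi>_\<psi>)
  ultimately show ?thesis by (metis has_derivative_unique o_apply id_apply)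
qed

lemma velocity_in_slice:
  assumes "(\<gamma> has_vector_derivative v) (at t within X)" "at t within X \<noteq> bot"
    and "t \<in> X" "\<gamma> ` X \<subseteq> M" "\<gamma> t \<in> U"
  shows "d\<phi> (\<gamma> t) v \<in> S"
proof (rule vector_derivative_in_subspace[OF subspace_S _ assms(2)])
  show "((\<phi> \<circ> \<gamma>) has_vector_derivative d\<phi> (\<gamma> t) v) (at t within X)"
    by (rule vector_derivative_diff_chain_within[OF assms(1) has_derivative_at_withinI[OF d\<phi>[OF assms(5)]]])
  have "(\<gamma> \<longlongrightarrow> \<gamma> t) (at t within X)"
    using has_vector_derivative_continuous[OF assms(1)] by (simp add: continuous_within)
  then have "\<forall>\<^sub>F s in at t within X. \<gamma> s \<in> U"
    using open_U assms(5) by (simp add: tendsto_def)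
  moreover have "\<forall>\<^sub>F s in at t within X. s \<in> X"
    by (simp add: eventually_at_filter)
  ultimately show "\<forall>\<^sub>F s in at t within X. (\<phi> \<circ> \<gamma>) s \<in> S"
    by eventually_elim (use assms(4) slice in auto)
  show "(\<phi> \<circ> \<gamma>) t \<in> S" using assms(3,4,5) slice by auto
qed

text \<open>A vector \<open>v\<close> that the chart maps into the slice is the velocity of the curve which is the straight
  line through \<open>\<phi>(p)\<close> in the chart.\<close>

lemma tangent_space_eq:
  assumes "p \<in> M \<inter> U"
  shows "tangent_space M p = {v. d\<phi> p v \<in> S}"
proof (intro set_eqI iffI)
  fix v assume "v \<in> tangent_space M p"
  then obtain e \<gamma> where e: "e > 0" "\<gamma> ` {-e<..<e} \<subseteq> M" "\<gamma> 0 = p" "(\<gamma> has_vector_derivative v) (at 0)"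
    unfolding tangent_space_def by blast
  have "d\<phi> (\<gamma> 0) v \<in> S"
  proof (rule velocity_in_slice)
    show "(\<gamma> has_vector_derivative v) (at 0 within {-e<..<e})"
      by (rule has_vector_derivative_at_within[OF e(4)])
    show "at 0 within {-e<..<e} \<noteq> bot"
      using e(1) by (simp add: at_within_open[of 0 "{-e<..<e}"])
  qed (use e assms in auto)
  then show "v \<in> {v. d\<phi> p v \<in> S}" using e(3) by simp
next
  fix v assume "v \<in> {v. d\<phi> p v \<in> S}"
  then have vS: "d\<phi> p v \<in> S" by simp
  define l where "l s = \<phi> p + s *\<^sub>R d\<phi> p v" for s :: real
  have pS: "\<phi> p \<in> S" using assms slice by auto
  have lS: "l s \<in> S" for s
    unfolding l_def using vS pS subspace_S by (simp add: subspace_add subspace_scale)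
  have cl: "continuous_on UNIV l" unfolding l_def by (intro continuous_intros)
  then have "open (l -` W)" using open_W by (simp add: open_vimage)
  moreover have "0 \<in> l -` W" using assms \<phi>_in by (simp add: l_def)
  ultimately obtain e where e: "e > 0" "ball 0 e \<subseteq> l -` W" using open_contains_ball by meson
  have ball: "ball 0 e = {-e<..<e}" by (simp add: ball_eq_greaterThanLessThan)
  have lW: "l ` {-e<..<e} \<subseteq> W" using e(2) ball by auto
  have sl: "smooth_on {-e<..<e} l"
    unfolding smooth_on_open_iff[OF open_greaterThanLessThan] l_def
  proof (intro allI Ck_on_add Ck_on_const Ck_on_scaleR open_greaterThanLessThan)
    show "Ck_on k {-e<..<e} (\<lambda>s. s)" for k
      by (cases k) (auto intro!: Ck_on_SucI[where f' = "\<lambda>x v. v"] Ck_on_const simp del: Ck_on.simps(2))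
  qed
  have "smooth_on {-e<..<e} (\<lambda>s. \<psi> (l s))"
    by (rule smooth_on_compose[OF open_greaterThanLessThan open_W sl smooth_\<psi> lW])
  moreover have "(\<lambda>s. \<psi> (l s)) ` {-e<..<e} \<subseteq> M"
    using \<psi>_slice lS lW by blast
  moreover have "\<psi> (l 0) = p" using assms \<psi>_\<phi> by (simp add: l_def)
  moreover have "((\<lambda>s. \<psi> (l s)) has_vector_derivative v) (at 0)"
  proof -
    have "(l has_vector_derivative d\<phi> p v) (at 0)"
      unfolding l_def by (auto intro!: derivative_eq_intros)
    moreover have "(\<psi> has_derivative d\<psi> (\<phi> p)) (at (l 0) within l ` UNIV)"
      using d\<psi>[OF \<phi>_in] assms by (auto simp: l_def intro: has_derivative_at_withinI)
    ultimately have "((\<psi> \<circ> l) has_vector_derivative d\<psi> (\<phi> p) (d\<phi> p v)) (at 0)"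
      by (rule vector_derivative_diff_chain_within)
    then show ?thesis using d\<psi>_d\<phi> assms by (simp add: o_def)
  qed
  ultimately show "v \<in> tangent_space M p"
    using e(1) unfolding tangent_space_def by blast
qed

end

lemma submanifold_slice_chart:
  assumes "submanifold m M" "p \<in> M"
  obtains U W \<phi> \<psi> S where "slice_chart M U W \<phi> \<psi> S" "p \<in> U"
  using assms unfolding submanifold_def slice_chart_def by metis

lemma subspace_tangent_space:
  assumes "submanifold m M" "p \<in> M"
  shows "subspace (tangent_space M p)"
proof -
  obtain U W \<phi> \<psi> S where "slice_chart M U W \<phi> \<psi> S" "p \<in> U"
    using submanifold_slice_chart[OF assms] .
  interpret slice_chart M U W \<phi> \<psi> S by fact
  have "linear (d\<phi> p)" using d\<phi>[OF \<open>p \<in> U\<close>] by (rule has_derivative_linear)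
  then have "subspace {v. d\<phi> p v \<in> S}"
    using subspace_S linear_subspace_vimage[of "d\<phi> p" S] by (simp add: vimage_def)
  then show ?thesis using tangent_space_eq assms(2) \<open>p \<in> U\<close> by simp
qed

lemma velocity_in_tangent_space:
  assumes "submanifold m M" "(\<gamma> has_vector_derivative v) (at t within X)" "at t within X \<noteq> bot"
    and "t \<in> X" "\<gamma> ` X \<subseteq> M"
  shows "v \<in> tangent_space M (\<gamma> t)"
proof -
  have "\<gamma> t \<in> M" using assms(4,5) by auto
  then obtain U W \<phi> \<psi> S where "slice_chart M U W \<phi> \<psi> S" and tU: "\<gamma> t \<in> U"
    using submanifold_slice_chart[OF assms(1)] by metis
  interpret slice_chart M U W \<phi> \<psi> S by fact
  show ?thesis
    using velocity_in_slice[OF assms(2-5) tU] tangent_space_eq \<open>\<gamma> t \<in> M\<close> tU by simp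
qed

text \<open>In a slice chart the field becomes \<open>d\<phi>(Z(s))\<close>, with values in the fixed closed subspace \<open>S\<close>. Since
  \<open>Z(t) = 0\<close>, the quotients \<open>d\<phi>(Z(s)) / (s - t)\<close> converge to \<open>d\<phi>(z)\<close>: no term with a derivative of
  \<open>d\<phi>\<close> appears.\<close>

lemma tangent_field_derivative_at_zero:
  assumes M: "submanifold m M" and nb: "at t within X \<noteq> bot"
    and \<gamma>: "t \<in> X" "\<gamma> ` X \<subseteq> M" "(\<gamma> \<longlongrightarrow> \<gamma> t) (at t within X)"
    and Z: "\<forall>\<^sub>F s in at t within X. Z s \<in> tangent_space M (\<gamma> s)" "Z t = 0"
      "(Z has_vector_derivative z) (at t within X)"
  shows "z \<in> tangent_space M (\<gamma> t)"
proof -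
  have tM: "\<gamma> t \<in> M" using \<gamma> by auto
  then obtain U W \<phi> \<psi> S where "slice_chart M U W \<phi> \<psi> S" and tU: "\<gamma> t \<in> U"
    using submanifold_slice_chart[OF M] by metis
  interpret slice_chart M U W \<phi> \<psi> S by fact
  have Zlim: "((\<lambda>s. Z s /\<^sub>R (s - t)) \<longlongrightarrow> z) (at t within X)"
    using has_vector_derivative_quotient_tendsto[OF Z(3)] Z(2) by simp
  have inU: "\<forall>\<^sub>F s in at t within X. \<gamma> s \<in> U"
    using \<gamma>(3) open_U tU by (simp add: tendsto_def)
  have lin: "linear (d\<phi> q)" if "q \<in> U" for q
    using d\<phi>[OF that] by (rule has_derivative_linear)
  have dlim: "((\<lambda>s. d\<phi> (\<gamma> s) b) \<longlongrightarrow> d\<phi> (\<gamma> t) b) (at t within X)" for b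
  proof -
    have "continuous_on U (\<lambda>q. d\<phi> q b)"
      by (intro smooth_on_imp_continuous_on open_U smooth_on_directional_derivative smooth_\<phi>)
    then have "isCont (\<lambda>q. d\<phi> q b) (\<gamma> t)"
      using open_U tU by (simp add: continuous_on_eq_continuous_at)
    then show ?thesis using \<gamma>(3) by (rule isCont_tendsto_compose)
  qed
  have "((\<lambda>s. \<Sum>b\<in>Basis. ((Z s /\<^sub>R (s - t)) \<bullet> b) *\<^sub>R d\<phi> (\<gamma> s) b) \<longlongrightarrow>
      (\<Sum>b\<in>Basis. (z \<bullet> b) *\<^sub>R d\<phi> (\<gamma> t) b)) (at t within X)"
    by (intro tendsto_intros Zlim dlim)
  then have lim: "((\<lambda>s. \<Sum>b\<in>Basis. ((Z s /\<^sub>R (s - t)) \<bullet> b) *\<^sub>R d\<phi> (\<gamma> s) b) \<longlongrightarrow> d\<phi> (\<gamma> t) z)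
      (at t within X)"
    by (simp only: linear_eq_sum_Basis[OF lin[OF tU], of z])
  have "\<forall>\<^sub>F s in at t within X. s \<in> X"
    by (simp add: eventually_at_filter)
  with inU Z(1) have ev: "\<forall>\<^sub>F s in at t within X.
      (\<Sum>b\<in>Basis. ((Z s /\<^sub>R (s - t)) \<bullet> b) *\<^sub>R d\<phi> (\<gamma> s) b) \<in> S"
  proof eventually_elim
    case (elim s)
    have "d\<phi> (\<gamma> s) (Z s) \<in> S" using elim tangent_space_eq \<gamma>(2) by auto
    then have "d\<phi> (\<gamma> s) (Z s /\<^sub>R (s - t)) \<in> S"
      using elim by (simp add: linear_scale[OF lin] subspace_scale[OF subspace_S])
    then show ?case
      by (simp only: linear_eq_sum_Basis[OF lin[OF elim(1)], symmetric])
  qed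
  have "d\<phi> (\<gamma> t) z \<in> S"
    by (rule Lim_in_closed_set[OF closed_subspace[OF subspace_S] ev nb lim])
  then show ?thesis using tangent_space_eq tM tU by simp
qed

text \<open>The coordinates of \<open>w\<close> in the chart are kept constant, so the field is the image under \<open>d\<psi>\<close> of a
  constant field with values in \<open>S\<close>.\<close>

lemma tangent_extension:
  assumes "submanifold m M" "p \<in> M" "w \<in> tangent_space M p"
  obtains U Y where "open U" "p \<in> U" "smooth_on U Y" "\<And>q. q \<in> M \<inter> U \<Longrightarrow> Y q \<in> tangent_space M q"
    "Y p = w"
proof -
  obtain U W \<phi> \<psi> S where "slice_chart M U W \<phi> \<psi> S" and pU: "p \<in> U"
    using submanifold_slice_chart[OF assms(1,2)] .
  interpret slice_chart M U W \<phi> \<psi> S by fact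
  define Y where "Y q = d\<psi> (\<phi> q) (d\<phi> p w)" for q
  have wS: "d\<phi> p w \<in> S" using tangent_space_eq assms(2,3) pU by simp
  show ?thesis
  proof
    show "smooth_on U Y" unfolding Y_def
      by (rule smooth_on_compose[OF open_U open_W smooth_\<phi>
            smooth_on_directional_derivative[OF open_W smooth_\<psi>]]) (use \<phi>_in in auto)
    show "Y q \<in> tangent_space M q" if "q \<in> M \<inter> U" for q
      using that tangent_space_eq[OF that] d\<phi>_d\<psi> wS by (simp add: Y_def)
    show "Y p = w" using d\<psi>_d\<phi>[OF pU] by (simp add: Y_def)
  qed (fact open_U pU)+
qed

section \<open>The Gauss formula along a curve\<close>

text \<open>At an endpoint of \<open>I\<close> the derivative of \<open>\<alpha>\<close> is one-sided, but it agrees with the two-sided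
  derivative of a local smooth extension \<open>g\<close>. Hence \<open>\<alpha>'\<close> is smooth on \<open>I\<close> again, and the acceleration
  is the derivative of \<open>\<alpha>'\<close> up to the endpoints.\<close>

lemma smooth_curve_local_derivative:
  assumes nb: "\<And>s. s \<in> I \<Longrightarrow> at s within I \<noteq> bot" and "smooth_on I \<alpha>" "t \<in> I"
  obtains U g where "open U" "t \<in> U" "\<And>k. Ck_on k U g"
    "\<And>s. s \<in> I \<inter> U \<Longrightarrow> (\<alpha> has_vector_derivative frechet_derivative g (at s) 1) (at s within I)"
    "\<And>s. s \<in> I \<inter> U \<Longrightarrow> curve_deriv I \<alpha> s = frechet_derivative g (at s) 1"
proof -
  obtain U g where U: "open U" "t \<in> U" "\<And>k. Ck_on k U g" "\<And>q. q \<in> I \<inter> U \<Longrightarrow> \<alpha> q = g q"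
    using assms(2,3) unfolding smooth_on_def by meson
  have D: "(\<alpha> has_vector_derivative frechet_derivative g (at s) 1) (at s within I)" if s: "s \<in> I \<inter> U" for s
  proof -
    have g: "(g has_derivative frechet_derivative g (at s)) (at s)"
      using Ck_on_Suc_has_derivative[OF U(3) U(1)] s by blast
    have "(\<lambda>x. x *\<^sub>R frechet_derivative g (at s) 1) = frechet_derivative g (at s)"
      by (rule ext) (simp add: linear_scale[OF has_derivative_linear[OF g], symmetric])
    then have gv: "(g has_vector_derivative frechet_derivative g (at s) 1) (at s within I)"
      by (simp only: has_vector_derivative_def has_derivative_at_withinI[OF g])
    have "\<forall>\<^sub>F x in nhds s. x \<in> U" using U(1) s by (simp add: eventually_nhds_in_open)
    then have "\<forall>\<^sub>F x in nhds s. x \<in> I \<longrightarrow> \<alpha> x = g x"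
      by eventually_elim (use U(4) in auto)
    from has_vector_derivative_cong_ev[OF this] show ?thesis using gv s U(4) by blast
  qed
  show ?thesis
  proof (rule that[OF U(1-3) D])
    show "curve_deriv I \<alpha> s = frechet_derivative g (at s) 1" if "s \<in> I \<inter> U" for s
      unfolding curve_deriv_def using vector_derivative_within[OF nb D] that by blast
  qed
qed

lemma has_vector_derivative_curve_deriv:
  assumes "\<And>s. s \<in> I \<Longrightarrow> at s within I \<noteq> bot" "smooth_on I \<alpha>" "t \<in> I"
  shows "(\<alpha> has_vector_derivative curve_deriv I \<alpha> t) (at t within I)"
  using smooth_curve_local_derivative[OF assms] assms(3) by (metis IntI)

lemma smooth_on_curve_deriv:
  assumes nb: "\<And>s. s \<in> I \<Longrightarrow> at s within I \<noteq> bot" and \<alpha>: "smooth_on I \<alpha>"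
  shows "smooth_on I (curve_deriv I \<alpha>)"
  unfolding smooth_on_def
proof
  fix t assume t: "t \<in> I"
  obtain U g where U: "open U" "t \<in> U" "\<And>k. Ck_on k U g"
    "\<And>s. s \<in> I \<inter> U \<Longrightarrow> curve_deriv I \<alpha> s = frechet_derivative g (at s) 1"
    using smooth_curve_local_derivative[OF nb \<alpha> t] by metis
  have "Ck_on k U (\<lambda>s. frechet_derivative g (at s) 1)" for k
    using U(3)[of "Suc k"] by simp
  then show "\<exists>U h. open U \<and> t \<in> U \<and> (\<forall>k. Ck_on k U h) \<and> (\<forall>s\<in>I \<inter> U. curve_deriv I \<alpha> s = h s)"
    using U by blast
qed

text \<open>For an arbitrary normal vector \<open>u\<close> in a Gauss decomposition of the derivative of a tangent
  extension of \<open>\<alpha>'(t)\<close>. It gives at once that \<open>u\<close> is unique and that \<open>u\<close> is the normal part of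
  the acceleration.\<close>

lemma acceleration_minus_normal_part_tangent:
  assumes M: "submanifold m M" and nb: "\<And>s. s \<in> I \<Longrightarrow> at s within I \<noteq> bot"
    and \<alpha>: "smooth_on I \<alpha>" "\<alpha> ` I \<subseteq> M" and t: "t \<in> I"
    and Y: "open U" "\<alpha> t \<in> U" "smooth_on U Y" "\<forall>q\<in>M \<inter> U. Y q \<in> tangent_space M q"
      "Y (\<alpha> t) = curve_deriv I \<alpha> t"
    and a: "a \<in> tangent_space M (\<alpha> t)" "frechet_derivative Y (at (\<alpha> t)) (curve_deriv I \<alpha> t) = a + u"
  shows "curve_deriv I (curve_deriv I \<alpha>) t - u \<in> tangent_space M (\<alpha> t)"
proof -
  define Z where "Z s = curve_deriv I \<alpha> s - Y (\<alpha> s)" for s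
  have d\<alpha>: "(\<alpha> has_vector_derivative curve_deriv I \<alpha> s) (at s within I)" if "s \<in> I" for s
    by (rule has_vector_derivative_curve_deriv[OF nb \<alpha>(1) that])
  have tM: "\<alpha> t \<in> M" using \<alpha> t by auto
  have lim: "(\<alpha> \<longlongrightarrow> \<alpha> t) (at t within I)"
    using has_vector_derivative_continuous[OF d\<alpha>[OF t]] by (simp add: continuous_within)
  have "((Y \<circ> \<alpha>) has_vector_derivative frechet_derivative Y (at (\<alpha> t)) (curve_deriv I \<alpha> t)) (at t within I)"
    by (rule vector_derivative_diff_chain_within[OF d\<alpha>[OF t]
          has_derivative_at_withinI[OF smooth_on_has_derivative[OF Y(1,3,2)]]])
  then have "(Z has_vector_derivative curve_deriv I (curve_deriv I \<alpha>) t - (a + u)) (at t within I)"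
    unfolding Z_def a(2)[symmetric]
    by (intro has_vector_derivative_diff has_vector_derivative_curve_deriv smooth_on_curve_deriv nb \<alpha> t)
      (simp_all add: o_def)
  moreover have "\<forall>\<^sub>F s in at t within I. \<alpha> s \<in> U"
    using lim Y(1,2) by (simp add: tendsto_def)
  moreover have "\<forall>\<^sub>F s in at t within I. s \<in> I"
    by (simp add: eventually_at_filter)
  ultimately have "curve_deriv I (curve_deriv I \<alpha>) t - (a + u) \<in> tangent_space M (\<alpha> t)"
  proof (intro tangent_field_derivative_at_zero[OF M nb[OF t] t \<alpha>(2) lim, of Z])
    assume "\<forall>\<^sub>F s in at t within I. \<alpha> s \<in> U" "\<forall>\<^sub>F s in at t within I. s \<in> I"
    then show "\<forall>\<^sub>F s in at t within I. Z s \<in> tangent_space M (\<alpha> s)"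
    proof eventually_elim
      case (elim s)
      then have "\<alpha> s \<in> M" using \<alpha>(2) by auto
      then show ?case unfolding Z_def
        using elim Y(4) velocity_in_tangent_space[OF M d\<alpha>[OF elim(2)] nb[OF elim(2)] elim(2) \<alpha>(2)]
        by (intro subspace_diff subspace_tangent_space[OF M]) auto
    qed
    show "Z t = 0" using Y(5) by (simp add: Z_def)
  qed auto
  then have "(curve_deriv I (curve_deriv I \<alpha>) t - (a + u)) + a \<in> tangent_space M (\<alpha> t)"
    using a(1) by (intro subspace_add subspace_tangent_space[OF M tM])
  then show ?thesis by simp
qed

text \<open>The second fundamental form is a definite description, so its value satisfies the defining
  decomposition only after existence and uniqueness are shown. The decomposition then relates it to the
  acceleration by the previous lemma.\<close>

lemma Gauss_formula_curve:
  assumes M: "submanifold m M" and nb: "\<And>s. s \<in> I \<Longrightarrow> at s within I \<noteq> bot"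
    and \<alpha>: "smooth_on I \<alpha>" "\<alpha> ` I \<subseteq> M" and t: "t \<in> I"
  shows "curve_deriv I (curve_deriv I \<alpha>) t -
      second_fundamental_form M (\<alpha> t) (curve_deriv I \<alpha> t) (curve_deriv I \<alpha> t) \<in> tangent_space M (\<alpha> t)"
proof -
  let ?v = "curve_deriv I \<alpha> t" and ?p = "\<alpha> t"
  let ?acc = "curve_deriv I (curve_deriv I \<alpha>) t"
  define P where "P u \<longleftrightarrow> (\<exists>U Y a. open U \<and> ?p \<in> U \<and> smooth_on U Y \<and>
        (\<forall>q\<in>M \<inter> U. Y q \<in> tangent_space M q) \<and> Y ?p = ?v \<and>
        a \<in> tangent_space M ?p \<and> u \<in> normal_space M ?p \<and>
        frechet_derivative Y (at ?p) ?v = a + u)" for u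
  have tM: "?p \<in> M" using \<alpha> t by auto
  have sub: "subspace (tangent_space M ?p)" by (rule subspace_tangent_space[OF M tM])
  have acc: "?acc - u \<in> tangent_space M ?p" if "P u" for u
    using that acceleration_minus_normal_part_tangent[OF M nb \<alpha> t] unfolding P_def by blast
  \<comment> \<open>Both \<open>\<alpha>'' - u\<close> and \<open>\<alpha>'' - u'\<close> are tangent, so \<open>u - u'\<close> is tangent and normal.\<close>
  have uniq: "u = u'" if "P u" "P u'" for u u'
  proof -
    have "(?acc - u') - (?acc - u) \<in> tangent_space M ?p"
      by (rule subspace_diff[OF sub acc[OF that(2)] acc[OF that(1)]])
    then have "u - u' \<in> tangent_space M ?p" by simp
    moreover have "u - u' \<in> normal_space M ?p"
      using that unfolding P_def by (intro subspace_diff subspace_orthogonal_comp) auto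
    ultimately have "(u - u') \<bullet> (u - u') = 0"
      unfolding orthogonal_comp_def orthogonal_def by blast
    then show ?thesis by simp
  qed
  obtain u where "P u"
  proof -
    have "?v \<in> tangent_space M ?p"
      by (rule velocity_in_tangent_space[OF M has_vector_derivative_curve_deriv[OF nb \<alpha>(1) t] nb[OF t] t \<alpha>(2)])
    then obtain U Y where Y: "open U" "?p \<in> U" "smooth_on U Y"
      "\<And>q. q \<in> M \<inter> U \<Longrightarrow> Y q \<in> tangent_space M q" "Y ?p = ?v"
      using tangent_extension[OF M tM] by metis
    obtain a u where "a \<in> tangent_space M ?p" "u \<in> normal_space M ?p"
      "frechet_derivative Y (at ?p) ?v = a + u"
      using subspace_sum_orthogonal_comp[OF sub] by (metis UNIV_I set_plus_elim)
    then have "P u" unfolding P_def using Y by blast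
    then show thesis by (rule that)
  qed
  then have "P (THE u. P u)" using uniq by (metis theI)
  then show ?thesis
    using acc unfolding second_fundamental_form_def P_def by blast
qed

section \<open>Slant helices in a strong helix submanifold\<close>

lemma interval_at_within_neq_bot:
  fixes I :: "real set"
  assumes "is_interval I" "interior I \<noteq> {}" "s \<in> I"
  shows "at s within I \<noteq> bot"
proof -
  have "I \<noteq> {x}" for x using assms(2) by auto
  then show ?thesis
    using connected_imp_perfect[OF is_interval_connected[OF assms(1)] assms(3)]
    by (simp add: trivial_limit_within)
qed

theorem theorem3p3:
  fixes M :: "(real ^ 'n) set" and \<alpha> :: "real \<Rightarrow> real ^ 'n" and I :: "real set"
    and d :: "real ^ 'n" and T :: "real ^ 'n \<Rightarrow> real ^ 'n" and r k :: nat
  assumes "k \<le> CARD('n)" and "submanifold (CARD('n) - k) M" and "strong_helix r M"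
    and "unit_speed_curve I \<alpha>" and "\<alpha> ` I \<subseteq> M"
    and "\<forall>t\<in>I. normal_curvature M I \<alpha> t = 0"
    and "\<forall>t\<in>I. curvature I \<alpha> t > 0"
    and "d \<in> helix_space M" and "norm d = 1" and "tangent_component M d T"
    and "(\<lambda>t. principal_normal I \<alpha> t \<bullet> T (\<alpha> t)) constant_on I"
  shows "slant_helix I \<alpha>"
proof -
  let ?N = "principal_normal I \<alpha>"
  have I: "is_interval I" "interior I \<noteq> {}" and \<alpha>: "smooth_on I \<alpha>"
    using assms(4) unfolding unit_speed_curve_def by auto
  note nb = interval_at_within_neq_bot[OF I]
  obtain \<theta> \<xi> where \<xi>: "\<And>p. p \<in> M \<Longrightarrow> \<xi> p \<in> normal_space M p"
    "\<And>p. p \<in> M \<Longrightarrow> d = cos \<theta> *\<^sub>R \<xi> p + sin \<theta> *\<^sub>R T p"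
    using assms(10) unfolding tangent_component_def by blast
  obtain c where c: "\<And>t. t \<in> I \<Longrightarrow> ?N t \<bullet> T (\<alpha> t) = c"
    using assms(11) unfolding constant_on_def by blast
  have "vec_angle (?N t) d = arccos (sin \<theta> * c)" if t: "t \<in> I" for t
  proof -
    have tM: "\<alpha> t \<in> M" using assms(5) t by auto
    have "curve_deriv I (curve_deriv I \<alpha>) t \<in> tangent_space M (\<alpha> t)"
      using Gauss_formula_curve[OF assms(2) nb \<alpha> assms(5) t] assms(6) t
      by (simp add: normal_curvature_def)
    then have "curve_deriv I (curve_deriv I \<alpha>) t \<bullet> \<xi> (\<alpha> t) = 0"
      using \<xi>(1)[OF tM] unfolding orthogonal_comp_def orthogonal_def by blast
    then have "?N t \<bullet> \<xi> (\<alpha> t) = 0" by (simp add: principal_normal_def)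
    then have "?N t \<bullet> d = sin \<theta> * c"
      using c[OF t] by (subst \<xi>(2)[OF tM]) (simp add: inner_add_right)
    moreover have "norm (?N t) = 1"
      using assms(7) t unfolding principal_normal_def by (auto simp: curvature_def)
    ultimately show ?thesis using assms(9) by (simp add: vec_angle_def)
  qed
  then have "(\<lambda>t. vec_angle (?N t) d) constant_on I"
    unfolding constant_on_def by blast
  then show ?thesis using assms(4,7,9) unfolding slant_helix_def by blast
qed

end
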